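(* For every bivariate copula $C$, Gini's gamma $\gamma_C$, Spearman's footrule $\varphi_C$ and the $W$-footrule coefficient $\Phi_C$ satisfy $$\gamma_C = \frac{2}{3}\,(\varphi_C + \Phi_C).$$
   Context: A (bivariate) copula $C$ is a distribution function on $[0,1]^2$ with uniform marginals on $[0,1]$; $\mathrm{d}C$ denotes integration with respect to the associated probability measure. Gini's gamma: $\gamma_C = 4\int_0^1 [C(u,u)+C(u,1-u)]\,\mathrm{d}u - 2$. Spearman's footrule: $\varphi_C = 1-3\int_0^1\int_0^1 |u-v|\,\mathrm{d}C(u,v)$. $W$-footrule coefficient: $\Phi_C = 3\int_0^1\int_0^1 |1-u-v|\,\mathrm{d}C(u,v) - 1$. *)

theory Defs
  imports "HOL-Probability.Probability"
begin

abbreviation unit_square :: "(real \<times> real) set" where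
  "unit_square \<equiv> {0..1} \<times> {0..1}"

definition has_law :: "(real \<Rightarrow> real \<Rightarrow> real) \<Rightarrow> (real \<times> real) measure \<Rightarrow> bool" where
  "has_law C M \<longleftrightarrow>
     prob_space M \<and> sets M = sets (restrict_space borel unit_square) \<and>
     (\<forall>u\<in>{0..1}. \<forall>v\<in>{0..1}. C u v = measure M ({0..u} \<times> {0..v}))"

text \<open>Only the values of \<open>C\<close> on the unit square matter; values elsewhere are unconstrained.\<close>

definition copula :: "(real \<Rightarrow> real \<Rightarrow> real) \<Rightarrow> bool" where
  "copula C \<longleftrightarrow>
     (\<exists>M. has_law C M) \<and> (\<forall>u\<in>{0..1}. C u 1 = u) \<and> (\<forall>v\<in>{0..1}. C 1 v = v)"

text \<open>The description below is proper for every copula, by \<open>has_law_unique\<close>.\<close>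

definition copula_measure :: "(real \<Rightarrow> real \<Rightarrow> real) \<Rightarrow> (real \<times> real) measure" where
  "copula_measure C = (THE M. has_law C M)"

definition gini_gamma :: "(real \<Rightarrow> real \<Rightarrow> real) \<Rightarrow> real" where
  "gini_gamma C = 4 * (LBINT u:{0..1}. C u u + C u (1 - u)) - 2"

definition spearman_footrule :: "(real \<Rightarrow> real \<Rightarrow> real) \<Rightarrow> real" where
  "spearman_footrule C = 1 - 3 * (\<integral>(u, v). \<bar>u - v\<bar> \<partial>copula_measure C)"

definition W_footrule :: "(real \<Rightarrow> real \<Rightarrow> real) \<Rightarrow> real" where
  "W_footrule C = 3 * (\<integral>(u, v). \<bar>1 - u - v\<bar> \<partial>copula_measure C) - 1"

lemma has_law_unique:
  assumes "has_law C M" "has_law C N"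
  shows "M = N"
proof -
  define E where "E = (\<lambda>K::(real \<times> real) measure. distr K borel (\<lambda>x. x))"
  have space: "space K = unit_square" and meas: "(\<lambda>x. x) \<in> measurable K borel"
    if "has_law C K" for K
  proof -
    have s: "sets K = sets (restrict_space borel unit_square)"
      using that by (simp add: has_law_def)
    show "space K = unit_square"
      using sets_eq_imp_space_eq[OF s] by (simp add: space_restrict_space)
    show "(\<lambda>x. x) \<in> measurable K borel"
      unfolding measurable_cong_sets[OF s refl] by (rule measurable_restrict_space1) simp
  qed
  have em: "emeasure (E K) {..(a, b)} =
      ennreal (if 0 \<le> a \<and> 0 \<le> b then C (min a 1) (min b 1) else 0)"
    if K: "has_law C K" for K and a b :: real
  proof -
    interpret prob_space K using K by (simp add: has_law_def)
    have eq: "{..(a, b)} \<inter> unit_square =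
      (if 0 \<le> a \<and> 0 \<le> b then {0..min a 1} \<times> {0..min b 1} else {})"
      by (auto simp: less_eq_prod_def)
    have "emeasure (E K) {..(a, b)} = emeasure K ({..(a, b)} \<inter> unit_square)"
      unfolding E_def by (subst emeasure_distr[OF meas[OF K]]) (auto simp: space[OF K])
    also have "\<dots> = ennreal (if 0 \<le> a \<and> 0 \<le> b then C (min a 1) (min b 1) else 0)"
      using K unfolding eq by (auto simp: has_law_def emeasure_eq_measure)
    finally show ?thesis .
  qed
  have "E M = E N"
  proof (rule measure_eqI_generator_eq[where E = "range (\<lambda>p::real \<times> real. {..p})"
        and \<Omega> = UNIV and A = "\<lambda>n. {..(real n, real n)}"])
    show "Int_stable (range (\<lambda>p::real \<times> real. {..p}))"
    proof (rule Int_stableI_image)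
      fix p q :: "real \<times> real"
      show "\<exists>r\<in>UNIV. {..p} \<inter> {..q} = {..r}"
        by (rule bexI[of _ "inf p q"]) auto
    qed
    show "emeasure (E M) X = emeasure (E N) X"
      if "X \<in> range (\<lambda>p::real \<times> real. {..p})" for X
      using that em[OF assms(1)] em[OF assms(2)] by auto
    show "sets (E M) = sigma_sets UNIV (range (\<lambda>p::real \<times> real. {..p}))"
      by (auto simp: E_def borel_eq_atMost)
    show "sets (E N) = sigma_sets UNIV (range (\<lambda>p::real \<times> real. {..p}))"
      by (auto simp: E_def borel_eq_atMost)
    show "(\<Union>n::nat. {..(real n, real n)}) = UNIV"
    proof -
      have "\<exists>n. p \<le> (real n, real n)" for p :: "real \<times> real"
      proof -
        obtain n where "max (fst p) (snd p) \<le> real n" using real_arch_simple by blast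
        then show ?thesis by (intro exI[of _ n]) (auto simp: less_eq_prod_def)
      qed
      then show ?thesis by auto
    qed
    show "emeasure (E M) {..(real n, real n)} \<noteq> \<infinity>" for n
      using em[OF assms(1)] by simp
  qed auto
  have restr: "emeasure K X = emeasure (E K) X"
    if K: "has_law C K" and X: "X \<in> sets (restrict_space borel unit_square)" for K X
  proof -
    have "X \<in> sets borel" "X \<subseteq> unit_square"
      using X by (auto simp: sets_restrict_space borel_closed closed_Times)
    then show ?thesis
      unfolding E_def by (subst emeasure_distr[OF meas[OF K]]) (auto simp: space[OF K] Int_absorb2)
  qed
  show ?thesis
    by (rule measure_eqI)
      (use assms restr \<open>E M = E N\<close> in \<open>auto simp: has_law_def\<close>)
qed

end

theory Submission
  imports Defs
begin

text \<open>Let \<open>(U, V)\<close> have law \<open>C\<close>. By Fubini, averaging \<open>C\<close> over the two diagonals gives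
  \<open>E[1 - max U V]\<close> and \<open>E[max 0 (1 - U - V)]\<close>, and uniformity of the marginals gives
  \<open>E U = E V = 1/2\<close>. The claim then follows by taking expectations in
  \<open>\<bar>U - V\<bar> = 2 max U V - U - V\<close> and \<open>\<bar>1 - U - V\<bar> = 2 max 0 (1 - U - V) - (1 - U - V)\<close>.\<close>

text \<open>Fubini for the indicator of the region between the graphs of \<open>a\<close> and
  \<open>b\<close>: slicing at \<open>t\<close> gives the measure on the left, slicing at
  \<open>x\<close> gives the length of the interval from \<open>a x\<close> to \<open>b x\<close>.
  The means of both coordinates and both diagonal integrals of the copula are instances with
  \<open>c = 0\<close> and \<open>d = 1\<close>.\<close>

lemma (in finite_measure) set_integral_measure_between:
  fixes a b :: "'a \<Rightarrow> real"
  assumes [measurable]: "a \<in> borel_measurable M" "b \<in> borel_measurable M"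
    and bounds: "\<And>x. x \<in> space M \<Longrightarrow> c \<le> a x" "\<And>x. x \<in> space M \<Longrightarrow> b x \<le> d"
  shows "set_integrable lborel {c..d} (\<lambda>t. measure M {x \<in> space M. a x \<le> t \<and> t \<le> b x})"
    and "(LBINT t:{c..d}. measure M {x \<in> space M. a x \<le> t \<and> t \<le> b x}) =
      (\<integral>x. max 0 (b x - a x) \<partial>M)"
proof -
  interpret P: pair_sigma_finite lborel M ..
  define S where "S = {p \<in> space (lborel \<Otimes>\<^sub>M M).
    fst p \<in> {c..d} \<and> a (snd p) \<le> fst p \<and> fst p \<le> b (snd p)}"
  have S[measurable]: "S \<in> sets (lborel \<Otimes>\<^sub>M M)"
    unfolding S_def by measurable
  \<comment> \<open>Fubini needs an integrable indicator; \<open>S\<close> lies in a box of finite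
    measure because \<open>M\<close> is finite and \<open>t\<close> is confined to
    \<open>{c..d}\<close>.\<close>
  have "emeasure (lborel \<Otimes>\<^sub>M M) S \<le> emeasure (lborel \<Otimes>\<^sub>M M) ({c..d} \<times> space M)"
    by (rule emeasure_mono) (auto simp: S_def space_pair_measure)
  also have "\<dots> = emeasure lborel {c..d} * emeasure M (space M)"
    by (rule emeasure_pair_measure_Times) auto
  also have "\<dots> < \<infinity>"
    by (auto simp: emeasure_lborel_Icc_eq emeasure_eq_measure ennreal_mult_less_top)
  finally have int: "integrable (lborel \<Otimes>\<^sub>M M) (indicator S :: _ \<Rightarrow> real)"
    using S by (simp add: integrable_indicator_iff)
  have "(\<integral>x. indicator S (t, x) \<partial>M) =
      indicator {c..d} t *\<^sub>R measure M {x \<in> space M. a x \<le> t \<and> t \<le> b x}" for t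
  proof -
    have "(\<integral>x. (indicator S (t, x) :: real) \<partial>M) =
        (\<integral>x. indicator {c..d} t * indicator {x \<in> space M. a x \<le> t \<and> t \<le> b x} x \<partial>M)"
      by (rule Bochner_Integration.integral_cong)
        (auto simp: S_def space_pair_measure indicator_def)
    then show ?thesis by (simp add: Int_absorb2 subset_iff)
  qed
  note inner = this
  show "set_integrable lborel {c..d} (\<lambda>t. measure M {x \<in> space M. a x \<le> t \<and> t \<le> b x})"
    using P.integrable_fst'[OF int] unfolding inner set_integrable_def .
  have "(LBINT t:{c..d}. measure M {x \<in> space M. a x \<le> t \<and> t \<le> b x}) =
      (\<integral>x. (\<integral>t. indicator S (t, x) \<partial>lborel) \<partial>M)"
    unfolding set_lebesgue_integral_def inner[symmetric]
    by (rule P.Fubini_integral[symmetric]) (use int in simp)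
  also have "\<dots> = (\<integral>x. max 0 (b x - a x) \<partial>M)"
  proof (rule Bochner_Integration.integral_cong[OF refl])
    fix x assume x: "x \<in> space M"
    \<comment> \<open>The bounds put a nonempty interval \<open>{a x..b x}\<close> inside
      \<open>{c..d}\<close>, so the cut to \<open>{c..d}\<close> loses nothing. If
      \<open>b x < a x\<close> the slice is empty, whence the \<open>max 0\<close>.\<close>
    have "(\<integral>t. (indicator S (t, x) :: real) \<partial>lborel) = (\<integral>t. indicator {a x..b x} t \<partial>lborel)"
      by (rule Bochner_Integration.integral_cong)
        (use x bounds[OF x] in \<open>auto simp: S_def space_pair_measure indicator_def\<close>)
    then show "(\<integral>t. indicator S (t, x) \<partial>lborel) = max 0 (b x - a x)"
      by (cases "a x \<le> b x") auto
  qed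
  finally show "(LBINT t:{c..d}. measure M {x \<in> space M. a x \<le> t \<and> t \<le> b x}) =
      (\<integral>x. max 0 (b x - a x) \<partial>M)" .
qed

lemma copula_measure_eq: "has_law C M \<Longrightarrow> copula_measure C = M"
  unfolding copula_measure_def by (blast intro: the_equality has_law_unique)

theorem mainTheorem1:
  fixes C :: "real \<Rightarrow> real \<Rightarrow> real"
  assumes "copula C"
  shows "gini_gamma C = 2 / 3 * (spearman_footrule C + W_footrule C)"
proof -
  obtain M where law: "has_law C M"
    using assms by (auto simp: copula_def)
  have margin: "C u 1 = u" "C 1 u = u" if "u \<in> {0..1}" for u
    using assms that by (auto simp: copula_def)
  interpret prob_space M using law by (simp add: has_law_def)
  have sets: "sets M = sets (restrict_space borel unit_square)"
    using law by (simp add: has_law_def)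
  have space: "space M = unit_square"
    using sets_eq_imp_space_eq[OF sets] by (simp add: space_restrict_space)
  have C: "C u v = prob ({0..u} \<times> {0..v})" if "u \<in> {0..1}" "v \<in> {0..1}" for u v
    using law that by (simp add: has_law_def)
  have [measurable]: "fst \<in> borel_measurable M" "snd \<in> borel_measurable M"
    unfolding measurable_cong_sets[OF sets refl]
    by (rule measurable_restrict_space1; simp add: borel_prod[symmetric])+
  have bounded: "integrable M f"
    if "f \<in> borel_measurable M" "\<And>x. x \<in> space M \<Longrightarrow> \<bar>f x\<bar> \<le> 2" for f :: "_ \<Rightarrow> real"
    using that by (intro integrable_const_bound[where B = 2]) auto
  have [simp]: "integrable M fst" "integrable M snd" "integrable M (\<lambda>x. max (fst x) (snd x))"
    "integrable M (\<lambda>x. max 0 (1 - fst x - snd x))"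
    by (rule bounded; force simp: space)+
  have unit_integral: "(LBINT t:{0..1::real}. t) = 1/2"
    using integral_power[of 0 1 1] unfolding set_lebesgue_integral_def
    by (simp add: mult.commute)

  \<comment> \<open>The uniform marginal enters here: the event has probability \<open>t\<close>, so
    integrating over \<open>t\<close> yields E[1 - U] = 1/2. The condition \<open>t \<le> 1\<close>
    only supplies the upper graph \<open>b = 1\<close>.\<close>
  have "(LBINT t:{0..1}. prob {x \<in> space M. fst x \<le> t \<and> t \<le> 1}) = (LBINT t:{0..1::real}. t)"
  proof (rule set_lebesgue_integral_cong, simp, intro allI impI)
    fix t :: real assume t: "t \<in> {0..1}"
    then have "{x \<in> space M. fst x \<le> t \<and> t \<le> 1} = {0..t} \<times> {0..1}" by (auto simp: space)
    then show "prob {x \<in> space M. fst x \<le> t \<and> t \<le> 1} = t" using C[of t 1] margin t by simp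
  qed
  also have "(LBINT t:{0..1}. prob {x \<in> space M. fst x \<le> t \<and> t \<le> 1}) =
      (\<integral>x. max 0 (1 - fst x) \<partial>M)"
    by (rule set_integral_measure_between) (auto simp: space)
  also have "\<dots> = (\<integral>x. 1 - fst x \<partial>M)"
    by (rule Bochner_Integration.integral_cong) (auto simp: space)
  finally have EU: "expectation fst = 1/2"
    by (simp add: unit_integral prob_space)

  have "(LBINT t:{0..1}. prob {x \<in> space M. snd x \<le> t \<and> t \<le> 1}) = (LBINT t:{0..1::real}. t)"
  proof (rule set_lebesgue_integral_cong, simp, intro allI impI)
    fix t :: real assume t: "t \<in> {0..1}"
    then have "{x \<in> space M. snd x \<le> t \<and> t \<le> 1} = {0..1} \<times> {0..t}" by (auto simp: space)
    then show "prob {x \<in> space M. snd x \<le> t \<and> t \<le> 1} = t" using C[of 1 t] margin t by simp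
  qed
  also have "(LBINT t:{0..1}. prob {x \<in> space M. snd x \<le> t \<and> t \<le> 1}) =
      (\<integral>x. max 0 (1 - snd x) \<partial>M)"
    by (rule set_integral_measure_between) (auto simp: space)
  also have "\<dots> = (\<integral>x. 1 - snd x \<partial>M)"
    by (rule Bochner_Integration.integral_cong) (auto simp: space)
  finally have EV: "expectation snd = 1/2"
    by (simp add: unit_integral prob_space)

  \<comment> \<open>Both coordinates lie below \<open>t\<close> exactly when their maximum does, so
    the lower graph is max U V and the upper one is again 1.\<close>
  have diag: "prob {x \<in> space M. max (fst x) (snd x) \<le> t \<and> t \<le> 1} = C t t"
    if t: "t \<in> {0..1}" for t
  proof -
    have "{x \<in> space M. max (fst x) (snd x) \<le> t \<and> t \<le> 1} = {0..t} \<times> {0..t}"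
      using t by (auto simp: space)
    then show ?thesis using C t by simp
  qed
  \<comment> \<open>Reading V \<le> 1 - t as t \<le> 1 - V turns the rectangle into a condition that
    \<open>t\<close> lies between U and 1 - V.\<close>
  have antidiag: "prob {x \<in> space M. fst x \<le> t \<and> t \<le> 1 - snd x} = C t (1 - t)"
    if t: "t \<in> {0..1}" for t
  proof -
    have "{x \<in> space M. fst x \<le> t \<and> t \<le> 1 - snd x} = {0..t} \<times> {0..1 - t}"
      using t by (auto simp: space)
    then show ?thesis using C t by simp
  qed
  have "(LBINT t:{0..1}. C t t + C t (1 - t)) =
      (LBINT t:{0..1}. prob {x \<in> space M. max (fst x) (snd x) \<le> t \<and> t \<le> 1} +
        prob {x \<in> space M. fst x \<le> t \<and> t \<le> 1 - snd x})"
    by (intro set_lebesgue_integral_cong allI impI, simp, simp only: diag antidiag)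
  also have "\<dots> =
      (LBINT t:{0..1}. prob {x \<in> space M. max (fst x) (snd x) \<le> t \<and> t \<le> 1}) +
      (LBINT t:{0..1}. prob {x \<in> space M. fst x \<le> t \<and> t \<le> 1 - snd x})"
    \<comment> \<open>Splitting the integral requires each summand to be integrable, which is the
      first conclusion of \<open>set_integral_measure_between\<close>.\<close>
    by (intro set_integral_add set_integral_measure_between) (auto simp: space)
  also have "\<dots> = (\<integral>x. max 0 (1 - max (fst x) (snd x)) \<partial>M) +
      (\<integral>x. max 0 (1 - snd x - fst x) \<partial>M)"
    by (intro arg_cong2[where f = "(+)"] set_integral_measure_between) (auto simp: space)
  also have "(\<integral>x. max 0 (1 - max (fst x) (snd x)) \<partial>M) = (\<integral>x. 1 - max (fst x) (snd x) \<partial>M)"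
    by (rule Bochner_Integration.integral_cong) (auto simp: space)
  also have "(\<integral>x. max 0 (1 - snd x - fst x) \<partial>M) = (\<integral>x. max 0 (1 - fst x - snd x) \<partial>M)"
    by (simp add: algebra_simps)
  finally have gini: "(LBINT t:{0..1}. C t t + C t (1 - t)) =
      1 - (\<integral>x. max (fst x) (snd x) \<partial>M) + (\<integral>x. max 0 (1 - fst x - snd x) \<partial>M)"
    by (simp add: prob_space)

  have "(\<integral>(u, v). \<bar>u - v\<bar> \<partial>M) = (\<integral>x. 2 * max (fst x) (snd x) - fst x - snd x \<partial>M)"
    by (rule Bochner_Integration.integral_cong) auto
  then have spearman: "(\<integral>(u, v). \<bar>u - v\<bar> \<partial>M) = 2 * (\<integral>x. max (fst x) (snd x) \<partial>M) - 1"
    by (simp add: EU EV)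
  have "(\<integral>(u, v). \<bar>1 - u - v\<bar> \<partial>M) =
      (\<integral>x. 2 * max 0 (1 - fst x - snd x) - (1 - fst x - snd x) \<partial>M)"
    by (rule Bochner_Integration.integral_cong) (auto simp: max_def)
  \<comment> \<open>The linear part drops out because 1 - E U - E V = 0.\<close>
  then have W: "(\<integral>(u, v). \<bar>1 - u - v\<bar> \<partial>M) = 2 * (\<integral>x. max 0 (1 - fst x - snd x) \<partial>M)"
    by (simp add: EU EV prob_space)
  \<comment> \<open>With m = E[max U V] and p = E[max 0 (1 - U - V)], the left side is 4(1 - m + p)
    - 2, while the footrules are 4 - 6m and 6p - 1.\<close>
  show ?thesis
    unfolding gini_gamma_def spearman_footrule_def W_footrule_def copula_measure_eq[OF law]
      gini spearman W
    by (simp add: field_simps)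
qed

end
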